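(* Let $(X;\leq)$ be a poset. (a) If every order component of $X$ (with the induced order) is representable, then $X$ is representable. (b) If $X$ is representable, then every order component $Y$ of $X$ is compact with respect to its own interval topology $\tau_i(Y)$. (c) There exists a representable poset having an order component which (with the induced order) is not representable.
   Context: A poset is representable if it is order-isomorphic to the poset of prime ideals (ordered by inclusion) of a bounded distributive lattice; equivalently, $(X;\leq)$ is representable iff there is a topology $\tau$ on $X$ such that $(X;\tau,\leq)$ is a Priestley space, i.e. $(X;\tau)$ is compact and whenever $x\not\geq y$ there is a clopen down-set $U$ with $x\in U$, $y\notin U$. For a poset $X$, let $R=\{(x,y): x\le y \text{ or } y\le x\}$ and $R'$ its transitive closure; an order component of $X$ is an equivalence class of $R'$. For $x\in X$, $(x]=\{z: z\le x\}$, $[x)=\{z: z\ge x\}$. The interval topology $\tau_i(X)$ is the topology with subbase $\{X\setminus (x]: x\in X\}\cup\{X\setminus [x): x\in X\}$. *)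

theory Defs
  imports "HOL-Analysis.Analysis"
begin

definition poset :: "'a set \<Rightarrow> ('a \<Rightarrow> 'a \<Rightarrow> bool) \<Rightarrow> bool" where
  "poset X le \<longleftrightarrow>
     (\<forall>x\<in>X. le x x) \<and>
     (\<forall>x\<in>X. \<forall>y\<in>X. le x y \<and> le y x \<longrightarrow> x = y) \<and>
     (\<forall>x\<in>X. \<forall>y\<in>X. \<forall>z\<in>X. le x y \<and> le y z \<longrightarrow> le x z)"

definition is_downset :: "'a set \<Rightarrow> ('a \<Rightarrow> 'a \<Rightarrow> bool) \<Rightarrow> 'a set \<Rightarrow> bool" where
  "is_downset X le U \<longleftrightarrow> U \<subseteq> X \<and> (\<forall>z\<in>U. \<forall>w\<in>X. le w z \<longrightarrow> w \<in> U)"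

definition priestley_space :: "'a set \<Rightarrow> 'a topology \<Rightarrow> ('a \<Rightarrow> 'a \<Rightarrow> bool) \<Rightarrow> bool" where
  "priestley_space X T le \<longleftrightarrow>
     topspace T = X \<and> compact_space T \<and>
     (\<forall>x\<in>X. \<forall>y\<in>X. \<not> le y x \<longrightarrow>
        (\<exists>U. openin T U \<and> closedin T U \<and> is_downset X le U \<and> x \<in> U \<and> y \<notin> U))"

text \<open>Representable poset (via the Priestley-space characterisation).\<close>
definition representable :: "'a set \<Rightarrow> ('a \<Rightarrow> 'a \<Rightarrow> bool) \<Rightarrow> bool" where
  "representable X le \<longleftrightarrow> (\<exists>T. priestley_space X T le)"

definition comparable :: "'a set \<Rightarrow> ('a \<Rightarrow> 'a \<Rightarrow> bool) \<Rightarrow> 'a \<Rightarrow> 'a \<Rightarrow> bool" where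
  "comparable X le x y \<longleftrightarrow> x \<in> X \<and> y \<in> X \<and> (le x y \<or> le y x)"

definition order_components :: "'a set \<Rightarrow> ('a \<Rightarrow> 'a \<Rightarrow> bool) \<Rightarrow> 'a set set" where
  "order_components X le = {{y. (comparable X le)\<^sup>+\<^sup>+ x y} | x. x \<in> X}"

definition down_closure :: "'a set \<Rightarrow> ('a \<Rightarrow> 'a \<Rightarrow> bool) \<Rightarrow> 'a \<Rightarrow> 'a set" where
  "down_closure X le x = {z \<in> X. le z x}"

definition up_closure :: "'a set \<Rightarrow> ('a \<Rightarrow> 'a \<Rightarrow> bool) \<Rightarrow> 'a \<Rightarrow> 'a set" where
  "up_closure X le x = {z \<in> X. le x z}"

text \<open>Interval topology on X: generated by the subbase of complements of principal
  down-sets and up-sets (X itself added so that the underlying space is X even when the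
  subbase is degenerate; this does not change the topology).\<close>
definition interval_topology :: "'a set \<Rightarrow> ('a \<Rightarrow> 'a \<Rightarrow> bool) \<Rightarrow> 'a topology" where
  "interval_topology X le = topology_generated_by
     (insert X ({X - down_closure X le x | x. x \<in> X} \<union> {X - up_closure X le x | x. x \<in> X}))"

end

theory Submission
  imports Defs
begin

text \<open>
  (a) Give \<open>X\<close> the disjoint sum of the topologies of its components, except that the
  neighbourhoods of one chosen point have to contain all but finitely many components.

  (b) In a Priestley space all sets \<open>(x]\<close> and \<open>[x)\<close> are compact, and for \<open>x\<close> in a
  component \<open>Y\<close> they lie inside \<open>Y\<close>; Alexander's subbase theorem does the rest.

  (c) Read a set of naturals as the strictly increasing word of its elements, so that the
  power set of the naturals, with the Cantor topology, consists of finite and infinite words.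
  A finite word \<open>w\<close> is the limit of its one-letter extensions \<open>wm\<close> for growing \<open>m\<close>.  Order
  them as a chain, decreasing to \<open>w\<close> if \<open>w\<close> has even length and increasing to \<open>w\<close> if it has
  odd length.  The order generated in this way makes the Cantor space a Priestley space,
  and the finite words form an order component \<open>Y\<close>.  In any Priestley topology on \<open>Y\<close> the set
  of words of length at most \<open>n\<close> is closed, because it arises from the empty word by taking
  \<open>n\<close> alternating up- and down-closures, and it has empty interior, because \<open>wm\<close> still
  converges to \<open>w\<close>.  As \<open>Y\<close> is the union of these countably many sets, this contradicts Baire's
  theorem.
\<close>

section \<open>Priestley spaces\<close>

lemma compactinE_image:
  assumes "compactin T K" "\<And>i. i \<in> I \<Longrightarrow> openin T (f i)" "K \<subseteq> \<Union>(f ` I)"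
  obtains J where "J \<subseteq> I" "finite J" "K \<subseteq> \<Union>(f ` J)"
proof -
  obtain \<F> where \<F>: "finite \<F>" "\<F> \<subseteq> f ` I" "K \<subseteq> \<Union>\<F>"
    using compactinD[of T K "f ` I"] assms by blast
  then show thesis
    using finite_subset_image[OF \<F>(1,2)] that by blast
qed

lemma up_closure_conversep: "up_closure X le\<inverse>\<inverse> = down_closure X le"
  by (auto simp: fun_eq_iff up_closure_def down_closure_def)

lemma is_downset_Diff_conversep: "is_downset X le U \<Longrightarrow> is_downset X le\<inverse>\<inverse> (X - U)"
  by (auto simp: is_downset_def)

lemma priestley_space_imp_topspace: "priestley_space X T le \<Longrightarrow> topspace T = X"
  by (simp add: priestley_space_def)

lemma priestley_space_imp_compact_space: "priestley_space X T le \<Longrightarrow> compact_space T"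
  by (simp add: priestley_space_def)

lemma priestley_space_clopen_downset:
  assumes "priestley_space X T le" "x \<in> X" "y \<in> X" "\<not> le y x"
  obtains U where "openin T U" "closedin T U" "is_downset X le U" "x \<in> U" "y \<notin> U"
  using assms unfolding priestley_space_def by blast

lemma priestley_space_conversep:
  assumes P: "priestley_space X T le"
  shows "priestley_space X T le\<inverse>\<inverse>"
proof -
  note top = priestley_space_imp_topspace[OF P]
  have "\<exists>U. openin T U \<and> closedin T U \<and> is_downset X le\<inverse>\<inverse> U \<and> x \<in> U \<and> y \<notin> U"
    if xy: "x \<in> X" "y \<in> X" "\<not> le\<inverse>\<inverse> y x" for x y
  proof -
    obtain U where "openin T U" "closedin T U" "is_downset X le U" "y \<in> U" "x \<notin> U"
      using priestley_space_clopen_downset[OF P xy(2,1)] xy(3) by blast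
    moreover from this have "openin T (X - U)" "closedin T (X - U)"
      using top by auto
    ultimately show ?thesis
      using is_downset_Diff_conversep xy(1) by (intro exI[of _ "X - U"]) auto
  qed
  then show ?thesis
    using P by (auto simp: priestley_space_def)
qed

lemma priestley_space_if_clopen_order:
  assumes "compact_space T" "topspace T = X"
    and clopen: "\<And>i. openin T (V i) \<and> closedin T (V i)"
    and le: "\<And>x y. \<lbrakk>x \<in> X; y \<in> X\<rbrakk> \<Longrightarrow> le x y \<longleftrightarrow> (\<forall>i. y \<in> V i \<longrightarrow> x \<in> V i)"
  shows "priestley_space X T le"
proof -
  have "is_downset X le (V i)" for i
    using le openin_subset[of T "V i"] clopen \<open>topspace T = X\<close> by (auto simp: is_downset_def)
  then show ?thesis
    unfolding priestley_space_def using assms by metis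
qed

lemma priestley_space_separate_compactin:
  assumes P: "priestley_space X T le" and F: "compactin T F"
    and y: "y \<in> X" "\<And>x. x \<in> F \<Longrightarrow> \<not> le x y"
  obtains W where "openin T W" "closedin T W" "is_downset X le W" "y \<in> W" "W \<inter> F = {}"
proof -
  note top = priestley_space_imp_topspace[OF P]
  let ?\<D> = "{U. openin T U \<and> closedin T U \<and> is_downset X le U \<and> y \<in> U}"
  have FX: "F \<subseteq> X"
    using compactin_subset_topspace[OF F] top by simp
  have "F \<subseteq> \<Union>((-) X ` ?\<D>)"
  proof
    fix x assume "x \<in> F"
    then have "x \<in> X" "\<not> le x y"
      using FX y by auto
    from priestley_space_clopen_downset[OF P y(1) this] show "x \<in> \<Union>((-) X ` ?\<D>)"
      using \<open>x \<in> X\<close> by blast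
  qed
  moreover have "openin T (X - U)" if "U \<in> ?\<D>" for U
    using that top by auto
  ultimately obtain \<F> where \<F>: "\<F> \<subseteq> ?\<D>" "finite \<F>" "F \<subseteq> \<Union>((-) X ` \<F>)"
    using compactinE_image[OF F, of ?\<D> "(-) X"] by blast
  let ?W = "\<Inter>(insert X \<F>)"
  have X: "openin T X" "closedin T X"
    using top openin_topspace[of T] closedin_topspace[of T] by simp_all
  have "openin T ?W"
    using \<F>(1,2) X by (intro openin_Inter) auto
  moreover have "closedin T ?W"
    using \<F>(1) X by (intro closedin_Inter) auto
  moreover have "is_downset X le ?W"
    using \<F>(1) unfolding is_downset_def by blast
  moreover have "y \<in> ?W" "?W \<inter> F = {}"
    using y(1) \<F>(1,3) by blast+
  ultimately show thesis
    by (rule that)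
qed

lemma priestley_space_closedin_UN_up_closure:
  assumes P: "priestley_space X T le" and F: "compactin T F"
  shows "closedin T (\<Union>x\<in>F. up_closure X le x)"
proof -
  let ?D = "\<Union>x\<in>F. up_closure X le x"
  note top = priestley_space_imp_topspace[OF P]
  have FX: "F \<subseteq> X"
    using compactin_subset_topspace[OF F] top by simp
  have "\<exists>W. openin T W \<and> y \<in> W \<and> W \<subseteq> X - ?D" if "y \<in> X - ?D" for y
  proof -
    have "y \<in> X" "\<And>x. x \<in> F \<Longrightarrow> \<not> le x y"
      using that by (auto simp: up_closure_def)
    from priestley_space_separate_compactin[OF P F this]
    obtain W where W: "openin T W" "is_downset X le W" "y \<in> W" "W \<inter> F = {}" .
    then have "W \<subseteq> X - ?D"
      using FX unfolding is_downset_def up_closure_def by blast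
    then show ?thesis
      using W by blast
  qed
  then have "openin T (X - ?D)"
    by (subst openin_subopen) blast
  moreover have "?D \<subseteq> X"
    by (auto simp: up_closure_def)
  ultimately show ?thesis
    by (simp add: closedin_def top)
qed

lemma priestley_space_closedin_up_closure:
  assumes "priestley_space X T le" "x \<in> X"
  shows "closedin T (up_closure X le x)"
  using priestley_space_closedin_UN_up_closure[OF assms(1), of "{x}"] assms
  by (simp add: priestley_space_imp_topspace)

lemma priestley_space_closedin_down_closure:
  assumes "priestley_space X T le" "x \<in> X"
  shows "closedin T (down_closure X le x)"
  using priestley_space_closedin_up_closure[OF priestley_space_conversep] assms
  by (metis up_closure_conversep)

lemma priestley_space_imp_Hausdorff_space:
  assumes P: "priestley_space X T le" and po: "poset X le"
  shows "Hausdorff_space T"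
proof -
  note top = priestley_space_imp_topspace[OF P]
  have separate: "\<exists>U V. openin T U \<and> openin T V \<and> x \<in> U \<and> y \<in> V \<and> disjnt U V"
    if xy: "x \<in> X" "y \<in> X" "\<not> le y x" for x y
  proof -
    obtain U where "openin T U" "closedin T U" "x \<in> U" "y \<notin> U"
      using priestley_space_clopen_downset[OF P xy] by blast
    then show ?thesis
      using xy top by (intro exI[of _ U] exI[of _ "X - U"]) (auto simp: disjnt_def)
  qed
  show ?thesis
    unfolding Hausdorff_space_def top
  proof (intro allI impI)
    fix x y assume xy: "x \<in> X \<and> y \<in> X \<and> x \<noteq> y"
    then have "\<not> le y x \<or> \<not> le x y"
      using po unfolding poset_def by blast
    then show "\<exists>U V. openin T U \<and> openin T V \<and> x \<in> U \<and> y \<in> V \<and> disjnt U V"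
      using separate[of x y] separate[of y x] xy disjnt_sym by metis
  qed
qed

lemma priestley_space_decreasing_limitin:
  fixes a :: "nat \<Rightarrow> 'a"
  assumes P: "priestley_space X T le" and po: "poset X le"
    and a: "\<And>m. a m \<in> X" "\<And>m n. m \<le> n \<Longrightarrow> le (a n) (a m)"
    and w: "w \<in> X" "\<And>m. le w (a m)"
    and maximal: "\<And>z. \<lbrakk>z \<in> X; le w z; \<And>m. le z (a m)\<rbrakk> \<Longrightarrow> z = w"
  shows "limitin T a w sequentially"
proof -
  note top = priestley_space_imp_topspace[OF P]
  have "\<exists>N. \<forall>n\<ge>N. a n \<in> U" if U: "openin T U" "w \<in> U" for U
  proof (rule ccontr)
    assume "\<nexists>N. \<forall>n\<ge>N. a n \<in> U"
    then have frequently: "\<exists>n\<ge>m. a n \<notin> U" for m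
      by blast
    define K where "K m = (X - U) \<inter> (up_closure X le w \<inter> down_closure X le (a m))" for m
    have "closedin T (X - U)"
      using U top by auto
    then have "closedin T (K m)" for m
      unfolding K_def using P a w
      by (intro closedin_Int priestley_space_closedin_up_closure
          priestley_space_closedin_down_closure)
    moreover have "K m \<noteq> {}" for m
      using frequently[of m] a w unfolding K_def up_closure_def down_closure_def by blast
    moreover have "decseq K"
      using po a unfolding decseq_def K_def down_closure_def poset_def by blast
    ultimately have "(\<Inter>m. K m) \<noteq> {}"
      using compact_space_imp_nest[OF priestley_space_imp_compact_space[OF P]] by blast
    then obtain z where z: "\<And>m. z \<in> K m"
      by blast
    then have "z = w"
      by (intro maximal) (auto simp: K_def up_closure_def down_closure_def)
    then show False
      using z[of 0] U by (simp add: K_def)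
  qed
  then show ?thesis
    using w top by (simp add: limitin_sequentially)
qed

section \<open>Order components\<close>

definition comparability_closed :: "'a set \<Rightarrow> ('a \<Rightarrow> 'a \<Rightarrow> bool) \<Rightarrow> 'a set \<Rightarrow> bool" where
  "comparability_closed X le Y \<longleftrightarrow> Y \<subseteq> X \<and> (\<forall>y\<in>Y. \<forall>z\<in>X. le y z \<or> le z y \<longrightarrow> z \<in> Y)"

lemma comparability_closed_Diff:
  "comparability_closed X le Y \<Longrightarrow> comparability_closed X le (X - Y)"
  unfolding comparability_closed_def by blast

lemma comparability_closed_imp_is_downset:
  assumes "comparability_closed X le Y" "is_downset Y le V"
  shows "is_downset X le V" "is_downset X le (X - (Y - V))"
proof -
  have Y: "y \<in> X" "z \<in> X \<Longrightarrow> le y z \<or> le z y \<Longrightarrow> z \<in> Y" if "y \<in> Y" for y z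
    using assms(1) that unfolding comparability_closed_def by blast+
  show "is_downset X le V" "is_downset X le (X - (Y - V))"
    using assms(2) Y unfolding is_downset_def by blast+
qed

lemma comparability_closed_tranclp:
  assumes "(comparable X le)\<^sup>+\<^sup>+ x y" "comparability_closed X le Y" "x \<in> Y"
  shows "y \<in> Y"
  using assms(1)
proof (induction rule: tranclp_induct)
  case (base y)
  then show ?case
    using assms(2,3) unfolding comparable_def comparability_closed_def by blast
next
  case (step y z)
  then show ?case
    using assms(2) unfolding comparable_def comparability_closed_def by blast
qed

lemma order_component_comparability_closed:
  assumes "Y \<in> order_components X le"
  shows "comparability_closed X le Y"
proof -
  obtain x where x: "x \<in> X" "Y = {y. (comparable X le)\<^sup>+\<^sup>+ x y}"
    using assms by (auto simp: order_components_def)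
  have "Y \<subseteq> X"
    using comparability_closed_tranclp[of X le x _ X] x by (auto simp: comparability_closed_def)
  moreover have "z \<in> Y" if "y \<in> Y" "z \<in> X" "le y z \<or> le z y" for y z
  proof -
    have "comparable X le y z"
      using that \<open>Y \<subseteq> X\<close> by (auto simp: comparable_def)
    then show ?thesis
      using that(1) by (simp add: x(2) tranclp.trancl_into_trancl)
  qed
  ultimately show ?thesis
    unfolding comparability_closed_def by blast
qed

lemma order_componentI:
  assumes "comparability_closed X le Y" "x \<in> Y" "\<And>y. y \<in> Y \<Longrightarrow> (comparable X le)\<^sup>+\<^sup>+ x y"
  shows "Y \<in> order_components X le"
proof -
  have "y \<in> Y \<longleftrightarrow> (comparable X le)\<^sup>+\<^sup>+ x y" for y
    using assms(3) comparability_closed_tranclp[OF _ assms(1,2)] by (rule iffI)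
  then have "Y = {y. (comparable X le)\<^sup>+\<^sup>+ x y}"
    by blast
  moreover have "x \<in> X"
    using assms(1,2) unfolding comparability_closed_def by blast
  ultimately show ?thesis
    unfolding order_components_def by blast
qed

lemma order_component_subset_comparability_closed:
  assumes Y: "Y \<in> order_components X le" and Z: "comparability_closed X le Z" and "Y \<inter> Z \<noteq> {}"
  shows "Y \<subseteq> Z"
proof -
  obtain x where x: "x \<in> X" "Y = {y. (comparable X le)\<^sup>+\<^sup>+ x y}"
    using Y by (auto simp: order_components_def)
  have "x \<in> Z"
  proof (rule ccontr)
    assume "x \<notin> Z"
    then have "Y \<subseteq> X - Z"
      using x(1) comparability_closed_tranclp[OF _ comparability_closed_Diff[OF Z]]
      unfolding x(2) by (metis DiffI mem_Collect_eq subsetI)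
    then show False
      using \<open>Y \<inter> Z \<noteq> {}\<close> by blast
  qed
  then show ?thesis
    using comparability_closed_tranclp[OF _ Z] unfolding x(2) by (metis mem_Collect_eq subsetI)
qed

lemma disjoint_order_components: "disjoint (order_components X le)"
proof (rule disjointI)
  fix Y Z assume YZ: "Y \<in> order_components X le" "Z \<in> order_components X le" "Y \<noteq> Z"
  show "Y \<inter> Z = {}"
  proof (rule ccontr)
    assume "Y \<inter> Z \<noteq> {}"
    then have "Y \<subseteq> Z" "Z \<subseteq> Y"
      using YZ order_component_subset_comparability_closed[of _ X le]
        order_component_comparability_closed[of _ X le]
      by (simp_all add: Int_commute)
    then show False
      using \<open>Y \<noteq> Z\<close> by blast
  qed
qed

lemma Union_order_components:
  assumes "poset X le"
  shows "\<Union>(order_components X le) = X"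
proof
  show "\<Union>(order_components X le) \<subseteq> X"
    using order_component_comparability_closed unfolding comparability_closed_def by blast
  have "(comparable X le)\<^sup>+\<^sup>+ x x" if "x \<in> X" for x
    using assms that unfolding comparable_def poset_def by (intro tranclp.r_into_trancl) blast
  then show "X \<subseteq> \<Union>(order_components X le)"
    unfolding order_components_def by blast
qed

section \<open>Sums of Priestley spaces\<close>

definition focal_sum_open :: "'a \<Rightarrow> 'i set \<Rightarrow> ('i \<Rightarrow> 'a topology) \<Rightarrow> 'a set \<Rightarrow> bool" where
  "focal_sum_open p I T U \<longleftrightarrow> U \<subseteq> (\<Union>i\<in>I. topspace (T i)) \<and>
     (\<forall>i\<in>I. openin (T i) (topspace (T i) \<inter> U)) \<and>
     (p \<in> U \<longrightarrow> finite {i \<in> I. \<not> topspace (T i) \<subseteq> U})"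

definition focal_sum_topology :: "'a \<Rightarrow> 'i set \<Rightarrow> ('i \<Rightarrow> 'a topology) \<Rightarrow> 'a topology" where
  "focal_sum_topology p I T = topology (focal_sum_open p I T)"

lemma istopology_focal_sum_open: "istopology (focal_sum_open p I T)"
proof -
  let ?opn = "focal_sum_open p I T"
  have "?opn (U \<inter> V)" if "?opn U" "?opn V" for U V
  proof -
    have "topspace (T i) \<inter> (U \<inter> V) = (topspace (T i) \<inter> U) \<inter> (topspace (T i) \<inter> V)" for i
      by blast
    moreover have "{i \<in> I. \<not> topspace (T i) \<subseteq> U \<inter> V} =
        {i \<in> I. \<not> topspace (T i) \<subseteq> U} \<union> {i \<in> I. \<not> topspace (T i) \<subseteq> V}"
      by blast
    ultimately show ?thesis
      using that unfolding focal_sum_open_def by (simp add: openin_Int le_infI1)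
  qed
  moreover have "?opn (\<Union>\<K>)" if \<K>: "\<forall>K\<in>\<K>. ?opn K" for \<K>
  proof -
    have "openin (T i) (topspace (T i) \<inter> \<Union>\<K>)" if "i \<in> I" for i
      unfolding Int_Union using \<K> that by (intro openin_Union) (auto simp: focal_sum_open_def)
    moreover have "finite {i \<in> I. \<not> topspace (T i) \<subseteq> \<Union>\<K>}" if "p \<in> K" "K \<in> \<K>" for K
    proof (rule finite_subset)
      show "finite {i \<in> I. \<not> topspace (T i) \<subseteq> K}"
        using \<K> that by (simp add: focal_sum_open_def)
    qed (use that in blast)
    ultimately show ?thesis
      using \<K> unfolding focal_sum_open_def by (auto simp: Sup_le_iff)
  qed
  ultimately show ?thesis
    by (simp add: istopology_def)
qed

lemma openin_focal_sum_topology: "openin (focal_sum_topology p I T) U \<longleftrightarrow> focal_sum_open p I T U"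
  by (simp add: focal_sum_topology_def istopology_focal_sum_open topology_inverse')

lemma topspace_focal_sum_topology:
  "topspace (focal_sum_topology p I T) = (\<Union>i\<in>I. topspace (T i))"
proof
  show "topspace (focal_sum_topology p I T) \<subseteq> (\<Union>i\<in>I. topspace (T i))"
    using openin_topspace[of "focal_sum_topology p I T"]
    unfolding openin_focal_sum_topology focal_sum_open_def by blast
  have "{i \<in> I. \<not> topspace (T i) \<subseteq> (\<Union>i\<in>I. topspace (T i))} = {}"
    by blast
  moreover have "topspace (T i) \<inter> (\<Union>i\<in>I. topspace (T i)) = topspace (T i)" if "i \<in> I" for i
    using that by blast
  ultimately have "openin (focal_sum_topology p I T) (\<Union>i\<in>I. topspace (T i))"
    unfolding openin_focal_sum_topology focal_sum_open_def
    by (metis finite.emptyI openin_topspace order_refl)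
  then show "(\<Union>i\<in>I. topspace (T i)) \<subseteq> topspace (focal_sum_topology p I T)"
    by (rule openin_subset)
qed

lemma closedin_focal_sum_topology:
  "closedin (focal_sum_topology p I T) C \<longleftrightarrow> C \<subseteq> (\<Union>i\<in>I. topspace (T i)) \<and>
     (\<forall>i\<in>I. closedin (T i) (topspace (T i) \<inter> C)) \<and>
     (p \<in> (\<Union>i\<in>I. topspace (T i)) - C \<longrightarrow> finite {i \<in> I. topspace (T i) \<inter> C \<noteq> {}})"
proof -
  let ?X = "\<Union>i\<in>I. topspace (T i)"
  have "topspace (T i) \<inter> (?X - C) = topspace (T i) - topspace (T i) \<inter> C"
    and "\<not> topspace (T i) \<subseteq> ?X - C \<longleftrightarrow> topspace (T i) \<inter> C \<noteq> {}" if "i \<in> I" for i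
    using that by blast+
  then show ?thesis
    by (auto simp: closedin_def topspace_focal_sum_topology openin_focal_sum_topology
        focal_sum_open_def cong: conj_cong)
qed

lemma compact_space_focal_sum_topology:
  assumes compact: "\<And>i. i \<in> I \<Longrightarrow> compact_space (T i)" and p: "p \<in> (\<Union>i\<in>I. topspace (T i))"
  shows "compact_space (focal_sum_topology p I T)"
  unfolding compact_space_alt
proof (intro allI impI)
  let ?S = "focal_sum_topology p I T"
  fix \<U> assume \<U>: "(\<forall>U\<in>\<U>. openin ?S U) \<and> topspace ?S \<subseteq> \<Union>\<U>"
  then obtain U where U: "U \<in> \<U>" "p \<in> U"
    using p by (auto simp: topspace_focal_sum_topology)
  let ?J = "{i \<in> I. \<not> topspace (T i) \<subseteq> U}"
  have "finite ?J"
    using \<U> U by (simp add: openin_focal_sum_topology focal_sum_open_def)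
  have "compactin ?S (topspace (T i))" if i: "i \<in> I" for i
  proof -
    have "continuous_map (T i) ?S id"
      using i unfolding continuous_map_def
      by (auto simp: topspace_focal_sum_topology openin_focal_sum_topology focal_sum_open_def
          Int_def)
    then show ?thesis
      using image_compactin compact[OF i] by (fastforce simp: compact_space_def)
  qed
  then have "compactin ?S (\<Union>i\<in>?J. topspace (T i))"
    using \<open>finite ?J\<close> by (intro compactin_Union) auto
  moreover have "(\<Union>i\<in>?J. topspace (T i)) \<subseteq> \<Union>\<U>"
    using \<U> by (auto simp: topspace_focal_sum_topology)
  ultimately obtain \<F> where "finite \<F>" "\<F> \<subseteq> \<U>" "(\<Union>i\<in>?J. topspace (T i)) \<subseteq> \<Union>\<F>"
    using compactinD \<U> by meson
  then show "\<exists>\<F>. finite \<F> \<and> \<F> \<subseteq> \<U> \<and> topspace ?S \<subseteq> \<Union>\<F>"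
    using U by (intro exI[of _ "insert U \<F>"]) (auto simp: topspace_focal_sum_topology)
qed

lemma clopen_focal_sum_topology:
  assumes disj: "disjoint_family_on (\<lambda>i. topspace (T i)) I" and i: "i \<in> I"
    and V: "openin (T i) V" "closedin (T i) V" "p \<notin> V"
  shows "openin (focal_sum_topology p I T) V" "closedin (focal_sum_topology p I T) V"
proof -
  have sub: "V \<subseteq> topspace (T i)"
    using V(1) by (rule openin_subset)
  have other: "topspace (T j) \<inter> V = {}" if "j \<in> I" "j \<noteq> i" for j
    using disjoint_family_onD[OF disj that(1) i that(2)] sub by blast
  have "openin (T j) (topspace (T j) \<inter> V) \<and> closedin (T j) (topspace (T j) \<inter> V)"
    if "j \<in> I" for j
    using V(1,2) sub other[OF that] by (cases "j = i") (simp_all add: Int_absorb1)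
  moreover have "{j \<in> I. topspace (T j) \<inter> V \<noteq> {}} \<subseteq> {i}"
    using other by blast
  then have "finite {j \<in> I. topspace (T j) \<inter> V \<noteq> {}}"
    by (rule finite_subset) simp
  ultimately show "openin (focal_sum_topology p I T) V" "closedin (focal_sum_topology p I T) V"
    unfolding openin_focal_sum_topology focal_sum_open_def closedin_focal_sum_topology
    using sub i V(3) by blast+
qed

lemma focal_sum_topology_extend_clopen_downset:
  assumes disj: "disjoint_family_on A I"
    and top: "\<And>i. i \<in> I \<Longrightarrow> topspace (T i) = A i"
    and cc: "\<And>i. i \<in> I \<Longrightarrow> comparability_closed (\<Union>i\<in>I. A i) le (A i)"
    and i: "i \<in> I" and j: "j \<in> I"
    and V: "openin (T i) V" "closedin (T i) V" "is_downset (A i) le V"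
  obtains U where "openin (focal_sum_topology p I T) U" "closedin (focal_sum_topology p I T) U"
    "is_downset (\<Union>i\<in>I. A i) le U" "V \<subseteq> U" "A j \<inter> U \<subseteq> V"
proof -
  let ?X = "\<Union>i\<in>I. A i" and ?S = "focal_sum_topology p I T"
  have disj_top: "disjoint_family_on (\<lambda>i. topspace (T i)) I"
    using disj top by (simp add: disjoint_family_on_def)
  have VA: "V \<subseteq> A i"
    using V(3) by (simp add: is_downset_def)
  show thesis
  proof (cases "p \<in> V")
    case False
    then show thesis
      using clopen_focal_sum_topology[OF disj_top i V(1,2)]
        comparability_closed_imp_is_downset(1)[OF cc[OF i] V(3)] that[of V] by blast
  next
    case True
    have "A j \<inter> V = (if i = j then V else {})"
      using VA disjoint_family_onD[OF disj i j] by auto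
    then have slice: "openin (T j) (A j \<inter> V)" "closedin (T j) (A j \<inter> V)"
      "is_downset (A j) le (A j \<inter> V)"
      using V by (auto simp: is_downset_def)
    have "A j - V = topspace (T j) - A j \<inter> V"
      using top[OF j] by blast
    then have "openin (T j) (A j - V)" "closedin (T j) (A j - V)"
      using slice(1,2) by (simp_all add: openin_diff closedin_diff)
    moreover have "p \<notin> A j - V"
      using True by blast
    ultimately have "openin ?S (A j - V)" "closedin ?S (A j - V)"
      by (rule clopen_focal_sum_topology[OF disj_top j])+
    moreover have "topspace ?S = ?X"
      using top by (simp add: topspace_focal_sum_topology)
    ultimately have "openin ?S (?X - (A j - V))" "closedin ?S (?X - (A j - V))"
      by (metis openin_diff openin_topspace, metis closedin_diff closedin_topspace)
    moreover have "is_downset ?X le (?X - (A j - V))"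
      using comparability_closed_imp_is_downset(2)[OF cc[OF j] slice(3)] by (simp add: Diff_Int)
    ultimately show thesis
      using VA i by (intro that[of "?X - (A j - V)"]) blast+
  qed
qed

lemma priestley_space_focal_sum_topology:
  assumes disj: "disjoint_family_on A I"
    and P: "\<And>i. i \<in> I \<Longrightarrow> priestley_space (A i) (T i) le"
    and cc: "\<And>i. i \<in> I \<Longrightarrow> comparability_closed (\<Union>i\<in>I. A i) le (A i)"
    and p: "p \<in> (\<Union>i\<in>I. A i)"
  shows "priestley_space (\<Union>i\<in>I. A i) (focal_sum_topology p I T) le"
proof -
  let ?X = "\<Union>i\<in>I. A i" and ?S = "focal_sum_topology p I T"
  have top: "topspace (T i) = A i" if "i \<in> I" for i
    using P[OF that] by (rule priestley_space_imp_topspace)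
  have "\<exists>U. openin ?S U \<and> closedin ?S U \<and> is_downset ?X le U \<and> x \<in> U \<and> y \<notin> U"
    if xy: "x \<in> ?X" "y \<in> ?X" "\<not> le y x" for x y
  proof -
    obtain i j where i: "i \<in> I" "x \<in> A i" and j: "j \<in> I" "y \<in> A j"
      using xy by blast
    obtain V where V: "openin (T i) V" "closedin (T i) V" "is_downset (A i) le V" "x \<in> V" "y \<notin> V"
    proof (cases "i = j")
      case True
      then show thesis
        using priestley_space_clopen_downset[OF P[OF i(1)] i(2) _ xy(3)] j(2) that by blast
    next
      case False
      then have "y \<notin> A i"
        using disjoint_family_onD[OF disj i(1) j(1)] j(2) by blast
      moreover have "openin (T i) (A i)" "closedin (T i) (A i)"
        using top[OF i(1)] openin_topspace[of "T i"] closedin_topspace[of "T i"] by simp_all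
      ultimately show thesis
        using that[of "A i"] i(2) by (simp add: is_downset_def)
    qed
    obtain U where "openin ?S U" "closedin ?S U" "is_downset ?X le U" "V \<subseteq> U" "A j \<inter> U \<subseteq> V"
      using focal_sum_topology_extend_clopen_downset[OF disj top cc i(1) j(1) V(1-3)] .
    then show ?thesis
      using V(4,5) j(2) by blast
  qed
  moreover have "compact_space ?S"
    using P p top by (intro compact_space_focal_sum_topology priestley_space_imp_compact_space) auto
  moreover have "topspace ?S = ?X"
    using top by (simp add: topspace_focal_sum_topology)
  ultimately show ?thesis
    by (simp add: priestley_space_def)
qed

lemma representable_UN:
  assumes disj: "disjoint_family_on A I"
    and rep: "\<And>i. i \<in> I \<Longrightarrow> representable (A i) le"
    and cc: "\<And>i. i \<in> I \<Longrightarrow> comparability_closed (\<Union>i\<in>I. A i) le (A i)"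
  shows "representable (\<Union>i\<in>I. A i) le"
proof (cases "(\<Union>i\<in>I. A i) = {}")
  case True
  have "priestley_space {} (discrete_topology {}) le"
    by (simp add: priestley_space_def compact_space_discrete_topology)
  then show ?thesis
    unfolding representable_def True by blast
next
  case False
  then obtain p where p: "p \<in> (\<Union>i\<in>I. A i)"
    by blast
  obtain T where "\<And>i. i \<in> I \<Longrightarrow> priestley_space (A i) (T i) le"
    using rep unfolding representable_def by metis
  from priestley_space_focal_sum_topology[OF disj this cc p] show ?thesis
    unfolding representable_def by blast
qed

lemma representable_if_order_components_representable:
  assumes "poset X le" "\<forall>Y\<in>order_components X le. representable Y le"
  shows "representable X le"
proof -
  have "disjoint_family_on (\<lambda>Y. Y) (order_components X le)"
    using disjoint_order_components by (simp add: disjoint_def disjoint_family_on_def)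
  from representable_UN[OF this, of le] show ?thesis
    using assms order_component_comparability_closed[of _ X le]
    by (simp add: Union_order_components)
qed

section \<open>Compactness of the interval topology\<close>

lemma compact_space_topology_generated_by:
  assumes "\<And>C. \<lbrakk>C \<subseteq> B; \<Union>C = \<Union>B\<rbrakk> \<Longrightarrow> \<exists>C'. finite C' \<and> C' \<subseteq> C \<and> \<Union>C' = \<Union>B"
  shows "compact_space (topology_generated_by B)"
proof -
  define S where
    "S = topology (arbitrary union_of (finite intersection_of (\<lambda>x. x \<in> B) relative_to \<Union>B))"
  have top: "topspace S = \<Union>B"
    by (simp add: S_def)
  have "compactin S (\<Union>B)"
    using Alexander_subbase[OF S_def[symmetric]] assms top by (simp add: compact_space_def)
  moreover have "continuous_map S (topology_generated_by B) id"
  proof (rule continuous_on_generated_topo)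
    fix s assume s: "s \<in> B"
    then have "(finite intersection_of (\<lambda>x. x \<in> B) relative_to \<Union>B) (\<Union>B \<inter> s)"
      by (intro relative_to_inc finite_intersection_of_inc)
    then show "openin S (id -` s \<inter> topspace S)"
      unfolding top unfolding S_def openin_subbase
      by (simp add: arbitrary_union_of_inc Int_commute)
  qed (simp add: top)
  ultimately show ?thesis
    using image_compactin by (fastforce simp: compact_space_def)
qed

lemma compact_space_generated_by_closed_complements:
  assumes T: "compact_space T" and "Y \<subseteq> topspace T" "\<Union>B \<subseteq> Y"
    and closed: "\<And>b. b \<in> B \<Longrightarrow> closedin T (Y - b)"
  shows "compact_space (topology_generated_by (insert Y B))"
proof (rule compact_space_topology_generated_by)
  fix C assume C: "C \<subseteq> insert Y B" "\<Union>C = \<Union>(insert Y B)"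
  have "\<Union>(insert Y B) = Y"
    using \<open>\<Union>B \<subseteq> Y\<close> by auto
  moreover have "\<exists>C'. finite C' \<and> C' \<subseteq> C \<and> \<Union>C' = Y"
  proof -
    consider (empty) "C = {}" | (whole) "Y \<in> C" | (proper) c where "c \<in> C" "C \<subseteq> B"
      using C by blast
    then show ?thesis
    proof cases
      case proper
      let ?f = "\<lambda>d. topspace T - (Y - d)"
      have "compactin T (Y - c)"
        using closed proper by (intro closedin_compact_space[OF T]) blast
      moreover have "openin T (?f d)" if "d \<in> C" for d
        using that closed proper(2) by blast
      moreover have "Y - c \<subseteq> \<Union>(?f ` C)"
        using C(2) \<open>Y \<subseteq> topspace T\<close> by blast
      ultimately obtain \<F> where \<F>: "\<F> \<subseteq> C" "finite \<F>" "Y - c \<subseteq> \<Union>(?f ` \<F>)"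
        by (rule compactinE_image)
      then have "Y \<subseteq> \<Union>(insert c \<F>)"
        by blast
      moreover have "\<Union>(insert c \<F>) \<subseteq> Y"
        using proper \<F>(1) \<open>\<Union>B \<subseteq> Y\<close> by blast
      ultimately show ?thesis
        using \<F>(1,2) proper(1) by (intro exI[of _ "insert c \<F>"]) blast
    qed (use C in auto)
  qed
  ultimately show "\<exists>C'. finite C' \<and> C' \<subseteq> C \<and> \<Union>C' = \<Union>(insert Y B)"
    by simp
qed

lemma compact_space_interval_topology:
  assumes P: "priestley_space X T le" and cc: "comparability_closed X le Y"
  shows "compact_space (interval_topology Y le)"
  unfolding interval_topology_def
proof (rule compact_space_generated_by_closed_complements)
  let ?B = "{Y - down_closure Y le x |x. x \<in> Y} \<union> {Y - up_closure Y le x |x. x \<in> Y}"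
  have YX: "Y \<subseteq> X"
    using cc by (simp add: comparability_closed_def)
  then show "Y \<subseteq> topspace T"
    using priestley_space_imp_topspace[OF P] by simp
  show "\<Union>?B \<subseteq> Y"
    by blast
  fix b assume "b \<in> ?B"
  then obtain x where x: "x \<in> Y" "Y - b = down_closure Y le x \<or> Y - b = up_closure Y le x"
    by (auto simp: down_closure_def up_closure_def)
  have "down_closure Y le x = down_closure X le x" "up_closure Y le x = up_closure X le x"
    using cc x(1) unfolding down_closure_def up_closure_def comparability_closed_def by blast+
  then show "closedin T (Y - b)"
    using x YX priestley_space_closedin_down_closure[OF P] priestley_space_closedin_up_closure[OF P]
    by (metis subsetD)
qed (rule priestley_space_imp_compact_space[OF P])

section \<open>The Cantor topology\<close>

definition cantor_topology :: "'a set topology" where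
  "cantor_topology = topology_generated_by (range (\<lambda>a. {A. a \<in> A}) \<union> range (\<lambda>a. {A. a \<notin> A}))"

lemma topspace_cantor_topology: "topspace cantor_topology = UNIV"
  by (auto simp: cantor_topology_def)

lemma compact_space_cantor_topology: "compact_space (cantor_topology :: 'a set topology)"
  unfolding cantor_topology_def
proof (rule compact_space_topology_generated_by)
  let ?B = "range (\<lambda>a. {A. a \<in> A}) \<union> range (\<lambda>a. {A. a \<notin> A}) :: 'a set set set"
  fix C assume C: "C \<subseteq> ?B" "\<Union>C = \<Union>?B"
  have UNIV: "\<Union>?B = UNIV"
    by auto
  then have "{a. {A. a \<notin> A} \<in> C} \<in> \<Union>C"
    using C(2) by simp
  then obtain c where c: "c \<in> C" "{a. {A. a \<notin> A} \<in> C} \<in> c"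
    by (elim UnionE)
  then obtain a where a: "{A. a \<notin> A} \<in> C" "{A. a \<in> A} \<in> C"
    using C(1) by auto
  then show "\<exists>C'. finite C' \<and> C' \<subseteq> C \<and> \<Union>C' = \<Union>?B"
    unfolding UNIV by (intro exI[of _ "{{A. a \<notin> A}, {A. a \<in> A}}"]) auto
qed

lemma openin_cantor_topology_cylinder:
  assumes "finite F"
  shows "openin cantor_topology {B. B \<inter> F = A \<inter> F}"
  using assms
proof (induction F)
  case empty
  then show ?case
    using openin_topspace[of cantor_topology] by (simp add: topspace_cantor_topology)
next
  case (insert a F)
  let ?E = "if a \<in> A then {B. a \<in> B} else {B. a \<notin> B}"
  have "openin cantor_topology ?E"
    unfolding cantor_topology_def by (rule topology_generated_by_Basis) auto
  moreover have "{B. B \<inter> insert a F = A \<inter> insert a F} = {B. B \<inter> F = A \<inter> F} \<inter> ?E"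
    using insert.hyps by auto
  ultimately show ?case
    using insert.IH by (simp only: openin_Int)
qed

lemma clopen_cantor_topology:
  assumes F: "finite F" and S: "\<And>A. A \<in> S \<longleftrightarrow> A \<inter> F \<in> S"
  shows "openin cantor_topology S \<and> closedin cantor_topology S"
proof -
  have openin_determined: "openin cantor_topology R" if R: "\<And>A. A \<in> R \<longleftrightarrow> A \<inter> F \<in> R" for R
  proof (subst openin_subopen, intro ballI)
    fix A assume "A \<in> R"
    then have "{B. B \<inter> F = A \<inter> F} \<subseteq> R"
      using R by (metis (mono_tags, lifting) mem_Collect_eq subsetI)
    then show "\<exists>T. openin cantor_topology T \<and> A \<in> T \<and> T \<subseteq> R"
      using openin_cantor_topology_cylinder[OF F, of A] by blast
  qed
  have "openin cantor_topology (UNIV - S)"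
    by (rule openin_determined) (use S in auto)
  then show ?thesis
    using openin_determined[OF S] by (simp add: closedin_def topspace_cantor_topology)
qed

section \<open>A component that is not representable\<close>

text \<open>\<open>branches C N A\<close>: the word \<open>A\<close> properly extends the word \<open>C\<close>, and the next letter is
  less than \<open>N\<close>.\<close>

definition branches :: "nat set \<Rightarrow> nat \<Rightarrow> nat set \<Rightarrow> bool" where
  "branches C N A \<longleftrightarrow> (\<exists>b<N. b \<in> A \<and> A \<inter> {..<b} = C)"

text \<open>Defining the order by clopen sets makes the Priestley separation property automatic;
  \<open>zigzag_le_insert\<close> and \<open>zigzag_le_insert_antimono\<close> give the intended chains.  The order
  described in (c) is \<open>zigzag_le True\<close>; the parity parameter lets the dual, \<open>zigzag_le False\<close>,
  share every argument.\<close>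

definition zigzag_le :: "bool \<Rightarrow> nat set \<Rightarrow> nat set \<Rightarrow> bool" where
  "zigzag_le p A B \<longleftrightarrow> (\<forall>C N. if even (card C) = p
     then branches C N A \<longrightarrow> branches C N B
     else branches C N B \<longrightarrow> branches C N A)"

lemma branches_initial_iff: "branches (A \<inter> {..<d}) (Suc d) A \<longleftrightarrow> d \<in> A"
proof
  assume "branches (A \<inter> {..<d}) (Suc d) A"
  then obtain b where b: "b < Suc d" "b \<in> A" "A \<inter> {..<b} = A \<inter> {..<d}"
    by (auto simp: branches_def)
  then have "\<not> b < d"
    by blast
  then show "d \<in> A"
    using b by (simp add: less_Suc_eq)
qed (auto simp: branches_def)

lemma branches_insert:
  assumes "A \<subseteq> {..<m}"
  shows "branches C N (insert m A) \<longleftrightarrow> branches C N A \<or> C = A \<and> m < N"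
proof -
  have "insert m A \<inter> {..<b} = A \<inter> {..<b}" if "b \<in> A" for b
    using assms that by auto
  moreover have "insert m A \<inter> {..<m} = A"
    using assms by auto
  ultimately show ?thesis
    unfolding branches_def by (metis insert_iff)
qed

lemma zigzag_le_Not: "zigzag_le (\<not> p) A B \<longleftrightarrow> zigzag_le p B A"
  by (auto simp: zigzag_le_def)

lemma zigzag_le_refl: "zigzag_le p A A"
  by (simp add: zigzag_le_def)

lemma zigzag_le_antisym:
  assumes "zigzag_le p A B" "zigzag_le p B A"
  shows "A = B"
proof -
  have branches: "branches C N A \<longleftrightarrow> branches C N B" for C N
    using assms unfolding zigzag_le_def by metis
  have "d \<in> A \<longleftrightarrow> d \<in> B" for d
  proof (induction d rule: less_induct)
    case (less d)
    then have "A \<inter> {..<d} = B \<inter> {..<d}"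
      by auto
    then show ?case
      using branches branches_initial_iff by metis
  qed
  then show ?thesis by blast
qed

lemma poset_zigzag_le: "poset X (zigzag_le p)"
  unfolding poset_def
proof (intro conjI ballI impI)
  show "zigzag_le p A C" if "zigzag_le p A B \<and> zigzag_le p B C" for A B C
    using that unfolding zigzag_le_def by (auto split: if_splits)
qed (use zigzag_le_refl zigzag_le_antisym in blast)+

lemma priestley_space_zigzag_le: "priestley_space UNIV cantor_topology (zigzag_le p)"
proof (rule priestley_space_if_clopen_order)
  define V where
    "V = (\<lambda>(C, N). if even (card C) = p then {A. \<not> branches C N A} else {A. branches C N A})"
  have "branches C N A \<longleftrightarrow> branches C N (A \<inter> {..<N})" for C N A
  proof -
    have "A \<inter> {..<N} \<inter> {..<b} = A \<inter> {..<b}" if "b < N" for b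
      using that by auto
    then show ?thesis
      by (auto simp: branches_def)
  qed
  then show "openin cantor_topology (V i) \<and> closedin cantor_topology (V i)" for i
    by (cases i) (auto simp: V_def intro!: clopen_cantor_topology[of "{..<snd i}"])
  show "zigzag_le p A B \<longleftrightarrow> (\<forall>i. B \<in> V i \<longrightarrow> A \<in> V i)" for A B
    by (auto simp: V_def zigzag_le_def)
qed (rule compact_space_cantor_topology, rule topspace_cantor_topology)

lemma zigzag_le_insert: "A \<subseteq> {..<m} \<Longrightarrow> zigzag_le (even (card A)) A (insert m A)"
  by (auto simp: zigzag_le_def branches_insert)

lemma zigzag_le_insert_antimono:
  assumes "A \<subseteq> {..<m}" "m \<le> n"
  shows "zigzag_le (even (card A)) (insert n A) (insert m A)"
proof -
  have "A \<subseteq> {..<n}"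
    using assms by auto
  then show ?thesis
    using assms by (auto simp: zigzag_le_def branches_insert)
qed

lemma zigzag_le_insert_maximal_lower_bound:
  assumes A: "A \<subseteq> {..<s}" and "zigzag_le p A B" and below: "\<And>m. zigzag_le p B (insert (m + s) A)"
  shows "B = A"
proof (rule zigzag_le_antisym)
  have "branches C N (insert (N + s) A) \<longleftrightarrow> branches C N A" for C N
    using A by (subst branches_insert) auto
  then show "zigzag_le p B A"
    using below unfolding zigzag_le_def by metis
qed fact

lemma initial_segment_of_card:
  fixes A :: "nat set"
  assumes "infinite A \<or> k < card A"
  shows "\<exists>b\<in>A. card (A \<inter> {..<b}) = k"
proof -
  obtain F where F: "finite F" "card F = Suc k" "F \<subseteq> A"
    using assms infinite_arbitrarily_large obtain_subset_with_card_n by (metis Suc_leI)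
  obtain n where "F \<subseteq> {..<n}"
    using finite_nat_bounded[OF F(1)] by blast
  then have "card F \<le> card (A \<inter> {..<n})"
    using F(3) by (intro card_mono) auto
  then have "k < card (A \<inter> {..<n})"
    using F(2) by simp
  then show ?thesis
  proof (induction n)
    case (Suc n)
    have "A \<inter> {..<Suc n} = (if n \<in> A then insert n (A \<inter> {..<n}) else A \<inter> {..<n})"
      by (auto simp: lessThan_Suc)
    then consider "k < card (A \<inter> {..<n})" | "n \<in> A" "card (A \<inter> {..<n}) = k"
      using Suc.prems by (fastforce split: if_splits)
    then show ?case
      using Suc.IH by cases auto
  qed simp
qed

lemma zigzag_le_common_initial_segment:
  assumes "zigzag_le p A B" "even k = p" "infinite A \<or> k < card A"
  obtains a b where "a \<in> A" "b \<in> B" "A \<inter> {..<a} = B \<inter> {..<b}" "card (A \<inter> {..<a}) = k"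
proof -
  obtain a where a: "a \<in> A" "card (A \<inter> {..<a}) = k"
    using initial_segment_of_card[OF assms(3)] by blast
  then have "branches (A \<inter> {..<a}) (Suc a) B"
    using assms(1,2) branches_initial_iff unfolding zigzag_le_def by metis
  then show thesis
    using a that by (auto simp: branches_def)
qed

lemma zigzag_le_imp_less_card:
  assumes "zigzag_le p A B" "even k = p" "k < card A" "finite B"
  shows "k < card B"
proof -
  obtain b where "b \<in> B" "card (B \<inter> {..<b}) = k"
    using zigzag_le_common_initial_segment[OF assms(1,2)] assms(3) by metis
  moreover from this have "B \<inter> {..<b} \<subset> B"
    by blast
  ultimately show ?thesis
    using psubset_card_mono[OF assms(4)] by metis
qed

lemma zigzag_le_infinite_imp_eq:
  assumes "zigzag_le p A B" "infinite A"
  shows "A = B"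
proof -
  have "A \<inter> {..<n} = B \<inter> {..<n}" for n
  proof -
    obtain k where k: "n \<le> k" "even k = p"
      by (metis even_Suc le_SucI order_refl)
    obtain a b where ab: "A \<inter> {..<a} = B \<inter> {..<b}" "card (A \<inter> {..<a}) = k"
      using zigzag_le_common_initial_segment[OF assms(1) k(2)] assms(2) by metis
    have "card (D \<inter> {..<c}) \<le> c" for D and c :: nat
      using card_mono[of "{..<c}" "D \<inter> {..<c}"] by simp
    from this[of A a] this[of B b] have "n \<le> a" "n \<le> b"
      using ab k(1) by simp_all
    then have "{..<n} = {..<a} \<inter> {..<n}" "{..<n} = {..<b} \<inter> {..<n}"
      by auto
    then show ?thesis
      using ab(1) by (metis Int_assoc)
  qed
  then show ?thesis
    by (metis IntE IntI lessI lessThan_iff subsetI subset_antisym)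
qed

lemma finite_sets_in_order_components: "{A. finite A} \<in> order_components UNIV (zigzag_le p)"
proof (rule order_componentI)
  have "finite B" if "finite A" "zigzag_le p A B \<or> zigzag_le p B A" for A B
    using that zigzag_le_infinite_imp_eq zigzag_le_Not by metis
  then show "comparability_closed UNIV (zigzag_le p) {A. finite A}"
    by (auto simp: comparability_closed_def)
  let ?R = "(comparable UNIV (zigzag_le p))\<^sup>+\<^sup>+"
  show "?R {} B" if "B \<in> {A. finite A}" for B
    using that unfolding mem_Collect_eq
  proof (induction B rule: finite_linorder_max_induct)
    case empty
    then show ?case
      by (auto simp: comparable_def zigzag_le_refl)
  next
    case (insert b A)
    then have "zigzag_le (even (card A)) A (insert b A)"
      by (intro zigzag_le_insert) auto
    then have "comparable UNIV (zigzag_le p) A (insert b A)"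
      using zigzag_le_Not[of p "insert b A" A]
      by (cases "even (card A) = p") (auto simp: comparable_def zigzag_le_Not)
    then show ?case
      using insert.IH by (rule tranclp.trancl_into_trancl[rotated])
  qed
qed simp

definition short_words :: "nat \<Rightarrow> nat set set" where
  "short_words n = {A. finite A \<and> card A \<le> n}"

lemma short_words_Suc:
  "short_words (Suc n) = (\<Union>A\<in>short_words n. up_closure {A. finite A} (zigzag_le (even n)) A)"
proof (intro equalityI subsetI)
  fix B assume B: "B \<in> short_words (Suc n)"
  have "\<exists>A\<in>short_words n. zigzag_le (even n) A B"
  proof (cases "card B \<le> n")
    case True
    then show ?thesis
      using B zigzag_le_refl by (auto simp: short_words_def)
  next
    case False
    let ?A = "B - {Max B}"
    have fin: "finite B" and card: "card B = Suc n"
      using B False by (auto simp: short_words_def)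
    then have "Max B \<in> B"
      by (intro Max_in) auto
    then have "insert (Max B) ?A = B" "card ?A = n"
      using fin card by auto
    moreover have "?A \<subseteq> {..<Max B}"
      using fin by (auto simp: less_le)
    ultimately show ?thesis
      using zigzag_le_insert[of ?A "Max B"] fin
      by (intro bexI[of _ ?A]) (simp_all add: short_words_def)
  qed
  then show "B \<in> (\<Union>A\<in>short_words n. up_closure {A. finite A} (zigzag_le (even n)) A)"
    using B by (auto simp: short_words_def up_closure_def)
next
  fix B assume "B \<in> (\<Union>A\<in>short_words n. up_closure {A. finite A} (zigzag_le (even n)) A)"
  then obtain A where A: "finite A" "card A \<le> n" "finite B" "zigzag_le (even n) A B"
    by (auto simp: short_words_def up_closure_def)
  have "zigzag_le (odd n) B A"
    using A(4) by (simp add: zigzag_le_Not)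
  then have "Suc n < card A" if "Suc n < card B"
    using zigzag_le_imp_less_card[OF _ _ that A(1)] by simp
  then show "B \<in> short_words (Suc n)"
    using A(2,3) by (force simp: short_words_def)
qed

lemma priestley_space_zigzag_le_change_parity:
  assumes "priestley_space X T (zigzag_le p)"
  shows "priestley_space X T (zigzag_le q)"
proof (cases "q = p")
  case False
  then have "zigzag_le q = (zigzag_le p)\<inverse>\<inverse>"
    using zigzag_le_Not[of p] by (auto simp: fun_eq_iff)
  then show ?thesis
    using priestley_space_conversep[OF assms] by simp
qed (use assms in simp)

lemma closedin_short_words:
  assumes P: "priestley_space {A. finite A} T (zigzag_le p)"
  shows "closedin T (short_words n)"
proof (induction n)
  case 0
  have "short_words 0 = {{}}"
    by (auto simp: short_words_def)
  then show ?case
    using priestley_space_imp_Hausdorff_space[OF P poset_zigzag_le]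
    by (simp add: closedin_Hausdorff_singleton priestley_space_imp_topspace[OF P])
next
  case (Suc n)
  then have "compactin T (short_words n)"
    by (rule closedin_compact_space[OF priestley_space_imp_compact_space[OF P]])
  then show ?case
    unfolding short_words_Suc
    using priestley_space_closedin_UN_up_closure[OF
        priestley_space_zigzag_le_change_parity[OF P]] by blast
qed

lemma limitin_insert:
  assumes P: "priestley_space {A. finite A} T (zigzag_le p)" and A: "finite A"
  shows "limitin T (\<lambda>m. insert m A) A sequentially"
proof -
  obtain s where s: "A \<subseteq> {..<s}"
    using finite_nat_bounded[OF A] by blast
  then have shifted: "A \<subseteq> {..<m + s}" for m
    by auto
  have "limitin T (\<lambda>m. insert (m + s) A) A sequentially"
  proof (rule priestley_space_decreasing_limitin)
    show "priestley_space {A. finite A} T (zigzag_le (even (card A)))"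
      using P by (rule priestley_space_zigzag_le_change_parity)
    show "zigzag_le (even (card A)) (insert (n + s) A) (insert (m + s) A)" if "m \<le> n" for m n
      using shifted that by (intro zigzag_le_insert_antimono) simp_all
    show "B = A" if "zigzag_le (even (card A)) A B"
      "\<And>m. zigzag_le (even (card A)) B (insert (m + s) A)" for B
      using s that by (rule zigzag_le_insert_maximal_lower_bound)
  qed (use A shifted in \<open>simp_all add: poset_zigzag_le zigzag_le_insert\<close>)
  then show ?thesis
    by (rule limitin_sequentially_offset_rev)
qed

lemma interior_of_short_words:
  assumes P: "priestley_space {A. finite A} T (zigzag_le p)"
  shows "T interior_of (short_words n) = {}"
  unfolding interior_of_eq_empty
proof (intro allI impI, rule ccontr)
  fix U assume U: "openin T U \<and> U \<subseteq> short_words n" "U \<noteq> {}"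
  then have fin: "finite A" "card A < Suc n" if "A \<in> U" for A
    using that by (auto simp: short_words_def)
  obtain A where A: "A \<in> U" and longest: "\<And>B. B \<in> U \<Longrightarrow> card B \<le> card A"
    using Lattices_Big.ex_has_greatest_nat[of "\<lambda>A. A \<in> U" _ card "Suc n"] U(2) fin(2) by blast
  obtain N where N: "\<And>m. m \<ge> N \<Longrightarrow> insert m A \<in> U"
    using limitin_insert[OF P fin(1)[OF A]] U(1) A unfolding limitin_sequentially by blast
  obtain s where "A \<subseteq> {..<s}"
    using finite_nat_bounded[OF fin(1)[OF A]] by blast
  then have "max N s \<notin> A"
    by auto
  then show False
    using N[of "max N s"] longest[of "insert (max N s) A"] fin(1)[OF A] by simp
qed

lemma finite_sets_not_representable: "\<not> representable {A. finite A} (zigzag_le p)"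
proof
  assume "representable {A. finite A} (zigzag_le p)"
  then obtain T where P: "priestley_space {A. finite A} T (zigzag_le p)"
    by (auto simp: representable_def)
  have "T interior_of (\<Union>(range short_words)) = {}"
  proof (rule Baire_category_alt)
    show "completely_metrizable_space T \<or> locally_compact_space T \<and> regular_space T"
      using priestley_space_imp_compact_space[OF P] priestley_space_imp_Hausdorff_space[OF P]
        poset_zigzag_le compact_imp_locally_compact_space compact_Hausdorff_imp_regular_space
      by blast
  qed (use closedin_short_words[OF P] interior_of_short_words[OF P] in auto)
  moreover have "\<Union>(range short_words) = topspace T"
    by (auto simp: short_words_def priestley_space_imp_topspace[OF P])
  ultimately have "{A :: nat set. finite A} = {}"
    using interior_of_topspace[of T] by (simp add: priestley_space_imp_topspace[OF P])
  then show False
    by blast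
qed

theorem theorem1p1:
  fixes X :: "'a set" and le :: "'a \<Rightarrow> 'a \<Rightarrow> bool"
  assumes "poset X le"
  shows "((\<forall>Y\<in>order_components X le. representable Y le) \<longrightarrow> representable X le)
    \<and> (representable X le \<longrightarrow>
         (\<forall>Y\<in>order_components X le. compact_space (interval_topology Y le)))
    \<and> (\<exists>(Z :: nat set set) r. poset Z r \<and> representable Z r \<and>
         (\<exists>Y\<in>order_components Z r. \<not> representable Y r))"
proof (intro conjI impI ballI)
  show "representable X le" if "\<forall>Y\<in>order_components X le. representable Y le"
    using assms that by (rule representable_if_order_components_representable)
  show "compact_space (interval_topology Y le)"
    if "representable X le" "Y \<in> order_components X le" for Y
    using that compact_space_interval_topology order_component_comparability_closed
    by (metis representable_def)
  have "representable UNIV (zigzag_le True)"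
    using priestley_space_zigzag_le by (auto simp: representable_def)
  then show "\<exists>(Z :: nat set set) r. poset Z r \<and> representable Z r \<and>
      (\<exists>Y\<in>order_components Z r. \<not> representable Y r)"
    using poset_zigzag_le finite_sets_in_order_components finite_sets_not_representable by blast
qed

end
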